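(* Let $\alpha>0$, $r>0$ and $\varepsilon>0$ be real numbers, and let $f:[0,\varepsilon)\to\mathbb{R}$ be a continuous function such that $$f(x)=x-\alpha x^{r+1}+O\left(x^{2r+1}\right),\quad x\to 0.$$ Then for every sufficiently small $x_0>0$, the sequence $\{x_n\}_{n\ge 0}$ defined by the recursion $x_{n+1}=f(x_n)$ satisfies, for every $0<\delta<1$, $$x_n=Cn^{-b}\left(1+O(n^{-\delta})\right),\quad n\to\infty,\qquad\text{where } b=\frac1r,\quad C=(\alpha r)^{-\frac1r}.$$
   Context: "For every sufficiently small $x_0>0$" means: there is $\varepsilon_0\in(0,\varepsilon)$, depending only on $f$, such that for all $x_0\in(0,\varepsilon_0)$ the sequence is well defined (all $x_n$ lie in $(0,\varepsilon)$) and the asymptotics holds. The constant implied by $O(n^{-\delta})$ may depend on $f$, $x_0$ and $\delta$. *)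

theory Defs
  imports "HOL-Analysis.Analysis" "HOL-Library.Landau_Symbols"
begin

end

theory Submission
  imports Defs "HOL-Real_Asymp.Real_Asymp"
begin

text \<open>
  The substitution \<open>y\<^sub>n = x\<^sub>n powr (- r)\<close> turns the recursion into
  \<open>y\<^sub>n\<^sub>+\<^sub>1 = y\<^sub>n + \<alpha> r + O(1 / y\<^sub>n)\<close>. Hence \<open>y\<^sub>n\<close> grows at least linearly, the error terms
  sum to a harmonic sum, and \<open>y\<^sub>n = \<alpha> r n + O(ln n)\<close>. Taking the power \<open>- 1 / r\<close> gives
  relative error \<open>O(ln n / n)\<close>, which is \<open>O(n powr (- \<delta>))\<close> for every \<open>\<delta> < 1\<close>.
\<close>

lemma harm_le_ln_plus_1:
  assumes "n > 0"
  shows "harm n \<le> ln (real n) + 1"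
  using euler_mascheroni_sequence_decreasing[of 1 n] assms by (simp add: harm_expand)

text \<open>The drift is written \<open>2 * c\<close> so that one half can absorb the error: while
  \<open>y n\<close> stays above \<open>y 0\<close>, the assumption \<open>M \<le> c * y 0\<close>
  gives \<open>M / y n \<le> c\<close>, and each step still gains at least \<open>c\<close>. The
  estimate \<open>step\<close> is available only above \<open>y 0\<close>, which the induction
  secures along the way.\<close>

lemma perturbed_arithmetic_progression_ge:
  fixes y :: "nat \<Rightarrow> real"
  assumes c: "c > 0" and M: "0 \<le> M" "M \<le> c * y 0" and y0: "c \<le> y 0"
    and step: "\<And>n. y 0 \<le> y n \<Longrightarrow> \<bar>y (Suc n) - y n - 2 * c\<bar> \<le> M / y n"
  shows "y n \<ge> y 0 + c * real n"
proof (induction n)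
  case (Suc n)
  have ge: "y 0 \<le> y n"
    using Suc.IH c by (smt (verit) mult_nonneg_nonneg of_nat_0_le_iff)
  have "M \<le> c * y n"
    using M ge c by (meson less_eq_real_def mult_left_mono order_trans)
  then have "M / y n \<le> c"
    using c y0 ge by (simp add: divide_le_eq)
  then show ?case
    using step[OF ge] Suc.IH by (simp add: algebra_simps)
qed simp

text \<open>The linear lower bound is fed back into the error: \<open>M / y n\<close> is at most
  \<open>M / c\<close> times the next harmonic term, and the errors telescope to
  \<open>harm n\<close>.\<close>

lemma perturbed_arithmetic_progression:
  fixes y :: "nat \<Rightarrow> real"
  assumes c: "c > 0" and M: "0 \<le> M" "M \<le> c * y 0" and y0: "c \<le> y 0"
    and step: "\<And>n. y 0 \<le> y n \<Longrightarrow> \<bar>y (Suc n) - y n - 2 * c\<bar> \<le> M / y n"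
  shows "\<bar>y n - y 0 - 2 * c * real n\<bar> \<le> M / c * harm n"
proof (induction n)
  case (Suc n)
  have lower: "y n \<ge> y 0 + c * real n"
    using perturbed_arithmetic_progression_ge[of c M y] assms by blast
  then have ge: "y 0 \<le> y n"
    using c by (smt (verit) mult_nonneg_nonneg of_nat_0_le_iff)
  \<comment> \<open>The assumption \<open>c \<le> y 0\<close> raises the factor from
    \<open>n\<close> to \<open>Suc n\<close>, which matches the new term of
    \<open>harm (Suc n)\<close> and covers n = 0.\<close>
  have "c * real (Suc n) \<le> y n"
    using lower y0 by (simp add: algebra_simps)
  then have "M / y n \<le> M / (c * real (Suc n))"
    using M(1) c by (intro divide_left_mono mult_pos_pos) (use y0 ge in auto)
  also have "\<dots> = M / c * inverse (real (Suc n))"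
    by (simp add: field_simps)
  finally have "\<bar>y (Suc n) - y n - 2 * c\<bar> \<le> M / c * inverse (real (Suc n))"
    using step[OF ge] by linarith
  moreover have "M / c * harm (Suc n) = M / c * harm n + M / c * inverse (real (Suc n))"
    by (simp only: harm_Suc distrib_left)
  ultimately show ?case
    using Suc.IH by (simp add: algebra_simps)
qed (simp add: harm_expand)

lemma powr_one_plus_bigo:
  fixes h :: "'a \<Rightarrow> real"
  assumes "b > 0" and "(h \<longlongrightarrow> 0) F"
  shows "(\<lambda>n. (1 + h n) powr (- b) - 1) \<in> O[F](h)"
proof -
  have "(\<lambda>h::real. (1 + h) powr (- b) - 1) \<in> O[at 0](\<lambda>h. h)"
    unfolding at_eq_sup_left_right using assms(1) by (intro landau_o.big.sup; real_asymp)
  then obtain K where "\<forall>\<^sub>F h in at 0. norm ((1 + h) powr (- b) - 1) \<le> K * norm (h :: real)"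
    by (auto elim: landau_o.bigE)
  \<comment> \<open>At h = 0 both sides vanish, so the point 0 can be added; this matters because
    \<open>h n\<close> may be 0 in the composition below.\<close>
  then have "\<forall>\<^sub>F h in nhds 0. norm ((1 + h) powr (- b) - 1) \<le> K * norm (h :: real)"
    by (simp add: eventually_nhds_conv_at)
  then have "\<forall>\<^sub>F n in F. norm ((1 + h n) powr (- b) - 1) \<le> K * norm (h n)"
    using assms(2) by (rule eventually_compose_filterlim)
  then show ?thesis
    by (rule bigoI)
qed

text \<open>A big-O bound passes to a smaller filter, so this carries the hypothesis on
  \<open>f\<close> over to \<open>at_right 0\<close>.\<close>

lemma at_right_le_at_within_atLeastLessThan:
  fixes a b :: real
  assumes "a < b"
  shows "at_right a \<le> at a within {a..<b}"
proof -
  have "at_right a = at a within ({a<..} \<inter> {..<b})"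
    using assms by (simp add: at_within_nhd[of a "{..<b}"])
  also have "\<dots> \<le> at a within {a..<b}"
    by (rule at_le) auto
  finally show ?thesis .
qed

text \<open>Write f(x) = x (1 - w(x)). Then w(x) is asymptotic to \<alpha> x^r, hence eventually
  between 0 and 1, which gives the first claim. The second comes from (1 - w)^(-r) = 1 + r w +
  O(w^2), multiplied by x^(-r).\<close>

lemma powr_neg_increment_bigo:
  fixes \<alpha> r :: real and f :: "real \<Rightarrow> real"
  assumes \<alpha>: "\<alpha> > 0" and r: "r > 0"
    and f: "(\<lambda>x. f x - (x - \<alpha> * x powr (r + 1))) \<in> O[at_right 0](\<lambda>x. x powr (2 * r + 1))"
  shows "\<forall>\<^sub>F x in at_right 0. 0 < f x \<and> f x < x"
    and "(\<lambda>x. f x powr (- r) - x powr (- r) - \<alpha> * r) \<in> O[at_right 0](\<lambda>x. x powr r)"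
proof -
  define w where "w x = 1 - f x / x" for x
  have pos: "\<forall>\<^sub>F x in at_right 0. (0::real) < x"
    by (simp add: eventually_at_right_less)
  have "(\<lambda>x. (f x - (x - \<alpha> * x powr (r + 1))) / x) \<in> O[at_right 0](\<lambda>x. x powr (2 * r + 1) / x)"
    using f by (intro landau_o.big.divide_right)
      (auto simp: eventually_at_filter)
  also have "?this \<longleftrightarrow> (\<lambda>x. - (w x - \<alpha> * x powr r)) \<in> O[at_right 0](\<lambda>x. x powr (2 * r))"
    by (intro landau_o.big.cong_ex eventually_mono[OF pos])
       (auto simp: w_def powr_add field_simps)
  finally have w1: "(\<lambda>x. w x - \<alpha> * x powr r) \<in> O[at_right 0](\<lambda>x. x powr (2 * r))"
    by (simp only: landau_o.big.uminus_in_iff)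
  moreover have "(\<lambda>x. x powr (2 * r)) \<in> o[at_right 0](\<lambda>x. \<alpha> * x powr r)"
    using r \<alpha> by real_asymp
  ultimately have "(\<lambda>x. w x - \<alpha> * x powr r) \<in> o[at_right 0](\<lambda>x. \<alpha> * x powr r)"
    by (rule landau_o.big_small_trans)
  then have equiv: "w \<sim>[at_right 0] (\<lambda>x. \<alpha> * x powr r)"
    by (rule smallo_imp_asymp_equiv)
  have lim: "(w \<longlongrightarrow> 0) (at_right 0)"
    by (rule asymp_equiv_symI[OF equiv, THEN tendsto_asymp_equiv_cong, THEN iffD1])
       (use r in real_asymp)
  have wpos: "\<forall>\<^sub>F x in at_right 0. 0 < w x"
    using asymp_equiv_eventually_pos_iff[OF equiv] pos
    by eventually_elim (use \<alpha> in auto)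
  have w_lt: "\<forall>\<^sub>F x in at_right 0. w x < 1"
    using lim by (rule order_tendstoD) simp
  show "\<forall>\<^sub>F x in at_right 0. 0 < f x \<and> f x < x"
    using pos wpos w_lt by eventually_elim (auto simp: w_def field_simps)
  have "(\<lambda>w::real. (1 - w) powr (- r) - 1 - r * w) \<in> O[at_right 0](\<lambda>w. w ^ 2)"
    using r by real_asymp
  \<comment> \<open>The expansion above is one-sided, so \<open>w\<close> must tend to 0 through
    positive values; this is where \<open>wpos\<close> enters.\<close>
  moreover have "filterlim w (at_right 0) (at_right 0)"
    using lim wpos by (auto simp: filterlim_at elim: eventually_mono)
  ultimately have "(\<lambda>x. (1 - w x) powr (- r) - 1 - r * w x) \<in> O[at_right 0](\<lambda>x. w x ^ 2)"
    by (rule landau_o.big.compose)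
  also have "(\<lambda>x. w x ^ 2) \<in> O[at_right 0](\<lambda>x. (\<alpha> * x powr r) ^ 2)"
    using equiv by (intro landau_o.big_power asymp_equiv_imp_bigo)
  also have "(\<lambda>x. (\<alpha> * x powr r) ^ 2) \<in> O[at_right 0](\<lambda>x. x powr (2 * r))"
    using r \<alpha> by real_asymp
  \<comment> \<open>Adding r times the estimate \<open>w1\<close> replaces r w(x) by \<alpha> r x^r
    at no cost in order. The factor x^(-r) applied next turns that term into the constant \<alpha> r
    and the error into O(x^r).\<close>
  finally have "(\<lambda>x. ((1 - w x) powr (- r) - 1 - r * w x) + r * (w x - \<alpha> * x powr r))
      \<in> O[at_right 0](\<lambda>x. x powr (2 * r))"
    using w1 r by (intro sum_in_bigo(1)) (simp_all only: landau_o.big.cmult_in_iff)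
  then have "(\<lambda>x. x powr (- r) * (((1 - w x) powr (- r) - 1 - r * w x) + r * (w x - \<alpha> * x powr r)))
      \<in> O[at_right 0](\<lambda>x. x powr (- r) * x powr (2 * r))"
    by (intro landau_o.big.mult) simp_all
  also have "?this \<longleftrightarrow> (\<lambda>x. f x powr (- r) - x powr (- r) - \<alpha> * r) \<in> O[at_right 0](\<lambda>x. x powr r)"
  proof (intro landau_o.big.cong_ex)
    show "\<forall>\<^sub>F x in at_right 0. x powr (- r) * (((1 - w x) powr (- r) - 1 - r * w x) + r * (w x - \<alpha> * x powr r))
        = f x powr (- r) - x powr (- r) - \<alpha> * r"
      using pos w_lt
    proof eventually_elim
      case (elim x)
      have "f x = x * (1 - w x)"
        using elim by (simp add: w_def)
      then have "f x powr (- r) = x powr (- r) * (1 - w x) powr (- r)"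
        using elim by (simp add: powr_mult)
      moreover have "x powr (- r) * x powr r = 1"
        using elim by (simp flip: powr_add)
      ultimately show ?case
        by (simp add: algebra_simps)
    qed
    show "\<forall>\<^sub>F x in at_right 0. x powr (- r) * x powr (2 * r) = x powr r"
      by (simp flip: powr_add)
  qed
  finally show "(\<lambda>x. f x powr (- r) - x powr (- r) - \<alpha> * r) \<in> O[at_right 0](\<lambda>x. x powr r)" .
qed

text \<open>With x_n^(-r) = a n (1 + h_n), the harmonic bound makes h_n = O(ln n / n). The logarithm
  is absorbed by any exponent \<delta> < 1, and the power -1/r preserves the order of the relative
  error.\<close>

lemma powr_asymp_of_linear_growth:
  fixes x :: "nat \<Rightarrow> real"
  assumes a: "a > 0" and r: "r > 0" and x: "\<And>n. x n > 0" and \<delta>: "\<delta> < 1" "\<delta> > 0"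
    and bound: "\<And>n. \<bar>x n powr (- r) - A - a * real n\<bar> \<le> B * harm n"
  shows "\<exists>g\<in>O[sequentially](\<lambda>n. real n powr (- \<delta>)).
    \<forall>\<^sub>F n in sequentially. x n = a powr (- 1 / r) * real n powr (- (1 / r)) * (1 + g n)"
proof -
  define h where "h n = x n powr (- r) / (a * real n) - 1" for n
  have "h \<in> O(\<lambda>n. (\<bar>A\<bar> + \<bar>B\<bar> * (ln (real n) + 1)) / (a * real n))"
  proof (intro landau_o.bigI[of 1] eventually_mono[OF eventually_gt_at_top[of 0]])
    fix n :: nat assume n: "n > 0"
    have "\<bar>x n powr (- r) - a * real n\<bar> \<le> \<bar>A\<bar> + B * harm n"
      using bound[of n] by linarith
    also have "B * harm n \<le> \<bar>B\<bar> * harm n"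
      by (intro mult_right_mono harm_nonneg) simp
    also have "\<bar>B\<bar> * harm n \<le> \<bar>B\<bar> * (ln (real n) + 1)"
      using harm_le_ln_plus_1[OF n] by (intro mult_left_mono) simp_all
    finally have *: "\<bar>x n powr (- r) - a * real n\<bar> \<le> \<bar>A\<bar> + \<bar>B\<bar> * (ln (real n) + 1)"
      by simp
    have "\<bar>h n\<bar> = \<bar>x n powr (- r) - a * real n\<bar> / (a * real n)"
    proof -
      have "h n = (x n powr (- r) - a * real n) / (a * real n)"
        using n a by (simp add: h_def diff_divide_distrib)
      then show ?thesis
        using a by (simp add: abs_mult)
    qed
    also have "\<dots> \<le> (\<bar>A\<bar> + \<bar>B\<bar> * (ln (real n) + 1)) / (a * real n)"
      using * n a by (intro divide_right_mono) simp_all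
    finally show "norm (h n) \<le> 1 * norm ((\<bar>A\<bar> + \<bar>B\<bar> * (ln (real n) + 1)) / (a * real n))"
      by (metis abs_ge_self mult_1 order_trans real_norm_def)
  qed simp
  also have "(\<lambda>n. (\<bar>A\<bar> + \<bar>B\<bar> * (ln (real n) + 1)) / (a * real n)) \<in> O(\<lambda>n. real n powr (- \<delta>))"
    using a \<delta> by real_asymp
  finally have h: "h \<in> O(\<lambda>n. real n powr (- \<delta>))" .
  also have "(\<lambda>n. real n powr (- \<delta>)) \<in> o(\<lambda>_. 1)"
    using \<delta> by real_asymp
  finally have "h \<longlonglongrightarrow> 0"
    using smalloD_tendsto by fastforce
  then have "(\<lambda>n. (1 + h n) powr (- (1 / r)) - 1) \<in> O(h)"
    using r by (intro powr_one_plus_bigo) simp_all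
  then have g: "(\<lambda>n. (1 + h n) powr (- (1 / r)) - 1) \<in> O(\<lambda>n. real n powr (- \<delta>))"
    using h by (rule landau_o.big_trans)
  \<comment> \<open>The witness for g is (1 + h_n)^(-1/r) - 1; the identity is exact for every n >
    0.\<close>
  have "\<forall>\<^sub>F n in sequentially. x n = a powr (- 1 / r) * real n powr (- (1 / r)) *
      (1 + ((1 + h n) powr (- (1 / r)) - 1))"
    using eventually_gt_at_top[of 0]
  proof eventually_elim
    case (elim n)
    have h_nonneg: "0 \<le> 1 + h n"
      using elim a by (simp add: h_def)
    have "x n = (x n powr (- r)) powr (- (1 / r))"
      using x[of n] r by (simp add: powr_powr)
    also have "x n powr (- r) = a * real n * (1 + h n)"
      using elim a by (simp add: h_def)
    also have "(a * real n * (1 + h n)) powr (- (1 / r)) =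
        a powr (- 1 / r) * real n powr (- (1 / r)) * (1 + h n) powr (- (1 / r))"
      using elim a h_nonneg by (simp add: powr_mult)
    finally show ?case
      by simp
  qed
  then show ?thesis
    by (rule bexI[OF _ g])
qed

theorem theorem3:
  fixes \<alpha> r \<epsilon> :: real and f :: "real \<Rightarrow> real"
  assumes "\<alpha> > 0" and "r > 0" and "\<epsilon> > 0"
    and "continuous_on {0..<\<epsilon>} f"
    and "(\<lambda>x. f x - (x - \<alpha> * x powr (r + 1))) \<in> O[at 0 within {0..<\<epsilon>}](\<lambda>x. x powr (2 * r + 1))"
  shows "\<exists>\<epsilon>\<^sub>0\<in>{0<..<\<epsilon>}. \<forall>x\<^sub>0\<in>{0<..<\<epsilon>\<^sub>0}. \<forall>x :: nat \<Rightarrow> real.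
           x 0 = x\<^sub>0 \<longrightarrow> (\<forall>n. x (Suc n) = f (x n)) \<longrightarrow>
           (\<forall>n. x n \<in> {0<..<\<epsilon>}) \<and>
           (\<forall>\<delta>. 0 < \<delta> \<and> \<delta> < 1 \<longrightarrow>
             (let b = 1 / r; C = (\<alpha> * r) powr (- 1 / r) in
               \<exists>g\<in>O[sequentially](\<lambda>n. real n powr (- \<delta>)).
                 \<forall>\<^sub>F n in sequentially. x n = C * real n powr (- b) * (1 + g n)))"
proof -
  note \<alpha> = assms(1) and r = assms(2) and \<epsilon> = assms(3)
  have f: "(\<lambda>x. f x - (x - \<alpha> * x powr (r + 1))) \<in> O[at_right 0](\<lambda>x. x powr (2 * r + 1))"
    using assms(5) at_right_le_at_within_atLeastLessThan[OF \<epsilon>] by (rule landau_o.big.filter_mono[rotated])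
  obtain M where M: "M > 0"
    "\<forall>\<^sub>F x in at_right 0. norm (f x powr (- r) - x powr (- r) - \<alpha> * r) \<le> M * norm (x powr r)"
    using powr_neg_increment_bigo(2)[OF \<alpha> r f] by (elim landau_o.bigE)
  \<comment> \<open>Half of the drift \<alpha> r, so that \<open>2 * c\<close> is the increment of
    the unperturbed progression.\<close>
  define c where "c = \<alpha> * r / 2"
  have c: "c > 0"
    using \<alpha> r by (simp add: c_def)
  have "filterlim (\<lambda>x::real. x powr (- r)) at_top (at_right 0)"
    using r by real_asymp
  then have large: "\<forall>\<^sub>F x in at_right 0. max c (M / c) \<le> x powr (- r)"
    unfolding filterlim_at_top by blast
  \<comment> \<open>All smallness conditions are collected on one interval (0, e), which
    \<open>f\<close> maps into itself since 0 < f(x) < x. The bound by \<open>max c (M / c)\<close>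
    becomes the two conditions on \<open>y 0\<close> for the progression lemma.\<close>
  have "\<forall>\<^sub>F x in at_right 0. x < \<epsilon> \<and> 0 < f x \<and> f x < x \<and> max c (M / c) \<le> x powr (- r) \<and>
      \<bar>f x powr (- r) - x powr (- r) - \<alpha> * r\<bar> \<le> M * x powr r"
    using powr_neg_increment_bigo(1)[OF \<alpha> r f] M(2) large order_tendstoD(2)[OF tendsto_ident_at \<epsilon>]
    by eventually_elim simp
  then obtain e where e: "e > 0"
    "\<And>x. 0 < x \<Longrightarrow> x < e \<Longrightarrow> x < \<epsilon> \<and> 0 < f x \<and> f x < x \<and> max c (M / c) \<le> x powr (- r) \<and>
      \<bar>f x powr (- r) - x powr (- r) - \<alpha> * r\<bar> \<le> M * x powr r"
    by (auto simp: eventually_at_right_field)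
  \<comment> \<open>Halving \<epsilon> makes \<open>\<epsilon>0\<close> strictly smaller than
    \<epsilon>, even if e equals \<epsilon>.\<close>
  define \<epsilon>0 where "\<epsilon>0 = min e (\<epsilon> / 2)"
  show ?thesis
  proof (intro bexI[of _ \<epsilon>0] ballI allI impI conjI)
    show "\<epsilon>0 \<in> {0<..<\<epsilon>}"
      using e(1) \<epsilon> by (auto simp: \<epsilon>0_def)
  next
    fix x\<^sub>0 and x :: "nat \<Rightarrow> real"
    assume x\<^sub>0: "x\<^sub>0 \<in> {0<..<\<epsilon>0}" and x: "x 0 = x\<^sub>0" "\<forall>n. x (Suc n) = f (x n)"
    have range: "0 < x n \<and> x n < e" for n
    proof (induction n)
      case (Suc n)
      then show ?case
        using e(2)[of "x n"] x(2) by auto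
    qed (use x(1) x\<^sub>0 in \<open>auto simp: \<epsilon>0_def\<close>)
    show "x n \<in> {0<..<\<epsilon>}" for n
      using range e(2)[of "x n"] by auto
    define y where "y n = x n powr (- r)" for n
    \<comment> \<open>Here M x_n^r is the same as \<open>M / y n\<close>, and invariance of (0, e)
      gives the estimate for every n.\<close>
    have step: "\<bar>y (Suc n) - y n - 2 * c\<bar> \<le> M / y n" for n
      using e(2)[of "x n"] range[of n] x(2) by (simp add: y_def c_def powr_minus_divide)
    have "max c (M / c) \<le> y 0"
      using e(2)[of "x 0"] range[of 0] by (simp add: y_def)
    then have "c \<le> y 0" "M \<le> c * y 0"
      using c by (simp_all add: field_simps)
    then have *: "\<bar>y n - y 0 - 2 * c * real n\<bar> \<le> M / c * harm n" for n
      using perturbed_arithmetic_progression[of c M y n] c M(1) step by simp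
    fix \<delta> :: real assume \<delta>: "0 < \<delta> \<and> \<delta> < 1"
    show "let b = 1 / r; C = (\<alpha> * r) powr (- 1 / r) in
        \<exists>g\<in>O[sequentially](\<lambda>n. real n powr (- \<delta>)).
          \<forall>\<^sub>F n in sequentially. x n = C * real n powr (- b) * (1 + g n)"
      unfolding Let_def
      by (rule powr_asymp_of_linear_growth[where A = "y 0" and B = "M / c"])
         (use \<alpha> r \<delta> range * in \<open>auto simp: y_def c_def\<close>)
  qed
qed

end
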